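(* There exist X-networks $\Sigma$ for which $\Delta\to\infty$ as $n\to\infty$. That is, there is a sequence of X-networks whose numbers of subsystems $n$ tend to infinity, together with structurally output controllable extended systems $\hat\Sigma$ of them, along which $\Delta=S-\hat S\to\infty$. Here $\hat S$ is the number of subsystems of $\Sigma$ replaced by higher-order ones in $\hat\Sigma$ (all other subsystems being left unmodified), and $S$ is the minimum number of subsystems of $\Sigma$ that need to be replaced with first-order heterogeneous ones to achieve structural output controllability.
   Context: **Original network.** $\Sigma$ is the structured system $\dot x=Ax+Bu$, $y=x$ (so the output matrix is $C=I_n$), with $x\in\mathbb{R}^n$, $u\in\mathbb{R}^m$. Each entry of $A\in\mathbb{R}^{n\times n}$ and $B\in\mathbb{R}^{n\times m}$ is either fixed to zero or a free (independent, arbitrary real) parameter, and all diagonal entries of $A$ are fixed to zero. The $i$-th component $x_i$ is the state of the $i$-th (first-order) subsystem; $a_{ij}$ ($i\neq j$) are the off-diagonal entries of $A$ and $b_{i,s}$ the entries of $B$. For entries of a structured matrix, "$\neq 0$" means "is a free parameter". **Extended system.** An extended system of $\Sigma$ is a structured system $\hat\Sigma$: $\dot{\hat x}=\hat A\hat x+\hat Bu$, $\hat y=\hat C\hat x$, with orders $\hat n_i\ge 1$ ($i=1,\dots,n$), $\hat n=\sum_i\hat n_i$, $\hat x=(\hat x_1,\dots,\hat x_n)$, $\hat x_i\in\mathbb{R}^{\hat n_i}$. The diagonal blocks of $\hat A$ are $\hat a_i\in\mathbb{R}^{\hat n_i\times\hat n_i}$ and the off-diagonal blocks are $\hat a_{ij}\in\mathbb{R}^{\hat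 n_i\times\hat n_j}$; $\hat B$ has block rows $\hat b_i\in\mathbb{R}^{\hat n_i\times m}$ with columns $\hat b_{i,s}$; $\hat C=\mathrm{diag}(\hat c_1,\dots,\hat c_n)\in\mathbb{R}^{n\times\hat n}$ with $\hat c_i\in\mathbb{R}^{1\times\hat n_i}$. Each entry of these matrices is free or fixed subject to the following. The entries of $\hat a_{ij}$ ($i\ne j$) may be free only if $a_{ij}\neq 0$, and are otherwise zero. The entries of $\hat b_{i,s}$ may be free only if $b_{i,s}\neq0$, and are otherwise zero. For each $i$, the entries of $\hat a_i$ are either all free (heterogeneous internal dynamics) or all fixed to zero (trivial internal dynamics). All entries of $\hat c_i$ are free if $\hat n_i>1$, and $\hat c_i=1$ if $\hat n_i=1$. Subsystem $i$ is replaced by a higher-order one if $\hat n_i>1$; it is replaced by a first-order heterogeneous one if $\hat n_i=1$ and $\hat a_i$ is a free scalar; it is unmodified if $\hat n_i=1$ and $\hat a_i=0$. **Structural (output) controllability.** A structured system with state dimension $N$ and matrices $(A,B,C)$ is structurally controllable if for some choice of the free parameters $\mathcal R=[B\ AB\ \cdots\ A^{N-1}B]$ has full row rank, and structurally output controllable if for some choice of the free parameters (including those of $C$) $C\mathcal R$ has full row rank. **Index $\Delta$.** $S$ is the minimum, over structurally output controllable extended systems of $\Sigma$ in which all orders are $1$, of the number of subsystems replaced by first-order heterogeneous ones; $\hat S$ is the number of subsystems in which higher-order dynamics is introduced to achieve structural output controllability of $\hat\Sigma$; $\Delta=S-\hat S$. **Graph.** $\mathrm G(\Sigma)$ is the directed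 graph whose nodes are the state nodes $x_1,\dots,x_n$ and the input nodes $u_1,\dots,u_m$, with an edge $(x_i,x_j)$ iff $A_{ji}\ne0$ and an edge $(u_i,x_j)$ iff $B_{ji}\neq0$. A stem is a sequence of distinct nodes $v_1,\dots,v_\ell$ with $(v_k,v_{k+1})$ an edge for all $k$, $v_1$ an input node and $v_\ell$ a state node. A cycle is a closed sequence $v_1,\dots,v_\ell=v_1$ with $(v_k,v_{k+1})$ an edge for all $k$ and $v_1,\dots,v_{\ell-1}$ distinct. A set of stems and cycles covers a set of nodes if each of these nodes lies on some member. $\Sigma$ is input-accessible if every state node is the end vertex of a stem. **Conditions on a set $\mathcal P$ of stems and cycles.** $\mathcal P$ contains: 1) a stem and a cycle sharing some node; 2) two (distinct) cycles sharing some node; 3) two stems sharing some node and originating from different input nodes; 4) two (distinct) stems originating from the same input node. **X-network.** An input-accessible network $\Sigma$ is an X-network if it is not structurally controllable and there exists a set of stems and cycles covering all state nodes of $\mathrm G(\Sigma)$ that satisfies (at least one of) conditions 1), 2), 3), but not 4). *)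

theory Defs
  imports
    "HOL.Real"
    "Jordan_Normal_Form.DL_Rank"
    "Graph_Theory.Graph_Theory"
begin

section \<open>Structured systems\<close>

datatype entry = Free | Fixed real

record structured_system =
  Amat :: "entry mat"
  Bmat :: "entry mat"
  Cmat :: "entry mat"

text \<open>A choice of the free parameters of \<open>S\<close> is a real matrix \<open>M\<close> that agrees with \<open>S\<close> in all
  fixed entries.\<close>

definition realises :: "real mat \<Rightarrow> entry mat \<Rightarrow> bool" where
  "realises M S \<longleftrightarrow> M \<in> carrier_mat (dim_row S) (dim_col S) \<and>
     (\<forall>i<dim_row S. \<forall>j<dim_col S. \<forall>r. S $$ (i, j) = Fixed r \<longrightarrow> M $$ (i, j) = r)"

text \<open>The block matrix \<open>[B, A B, \<dots>, A\<^sup>N\<^sup>-\<^sup>1 B]\<close> with \<open>N = dim_row A\<close>: if \<open>B\<close> has \<open>m\<close> columns, column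
  \<open>q * m + s\<close> with \<open>s < m\<close> is the \<open>s\<close>-th column of \<open>A\<^sup>q B\<close>.\<close>

definition controllability_matrix :: "real mat \<Rightarrow> real mat \<Rightarrow> real mat" where
  "controllability_matrix A B =
     mat (dim_row A) (dim_row A * dim_col B)
       (\<lambda>(i, j). (A ^\<^sub>m (j div dim_col B) * B) $$ (i, j mod dim_col B))"

definition full_row_rank :: "real mat \<Rightarrow> bool" where
  "full_row_rank M \<longleftrightarrow> vec_space.rank (dim_row M) M = dim_row M"

definition structurally_controllable :: "structured_system \<Rightarrow> bool" where
  "structurally_controllable \<Sigma> \<longleftrightarrow>
     (\<exists>A B. realises A (Amat \<Sigma>) \<and> realises B (Bmat \<Sigma>) \<and>
        full_row_rank (controllability_matrix A B))"

definition structurally_output_controllable :: "structured_system \<Rightarrow> bool" where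
  "structurally_output_controllable \<Sigma> \<longleftrightarrow>
     (\<exists>A B C. realises A (Amat \<Sigma>) \<and> realises B (Bmat \<Sigma>) \<and> realises C (Cmat \<Sigma>) \<and>
        full_row_rank (C * controllability_matrix A B))"


section \<open>Networks of first-order subsystems\<close>

abbreviation num_subsystems :: "structured_system \<Rightarrow> nat" where
  "num_subsystems \<Sigma> \<equiv> dim_row (Amat \<Sigma>)"

abbreviation num_inputs :: "structured_system \<Rightarrow> nat" where
  "num_inputs \<Sigma> \<equiv> dim_col (Bmat \<Sigma>)"

definition network :: "structured_system \<Rightarrow> bool" where
  "network \<Sigma> \<longleftrightarrow>
     (let n = num_subsystems \<Sigma>; m = num_inputs \<Sigma> in
       Amat \<Sigma> \<in> carrier_mat n n \<and> Bmat \<Sigma> \<in> carrier_mat n m \<and>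
       (\<forall>i<n. \<forall>j<n. Amat \<Sigma> $$ (i, j) \<in> {Free, Fixed 0}) \<and>
       (\<forall>i<n. Amat \<Sigma> $$ (i, i) = Fixed 0) \<and>
       (\<forall>i<n. \<forall>s<m. Bmat \<Sigma> $$ (i, s) \<in> {Free, Fixed 0}) \<and>
       Cmat \<Sigma> = mat n n (\<lambda>(i, j). Fixed (if i = j then 1 else 0)))"


section \<open>Extended systems\<close>

text \<open>\<open>\<nu> i\<close> is the order of the \<open>i\<close>-th subsystem of the extended system (only the values for
  \<open>i < num_subsystems \<Sigma>\<close> matter), and \<open>pos \<nu> i k\<close> is the position, in the extended state vector,
  of the \<open>k\<close>-th component of the state of that subsystem.\<close>

definition pos :: "(nat \<Rightarrow> nat) \<Rightarrow> nat \<Rightarrow> nat \<Rightarrow> nat" where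
  "pos \<nu> i k = (\<Sum>j<i. \<nu> j) + k"

definition heterogeneous :: "(nat \<Rightarrow> nat) \<Rightarrow> structured_system \<Rightarrow> nat \<Rightarrow> bool" where
  "heterogeneous \<nu> \<Sigma>' i \<longleftrightarrow>
     (\<forall>k<\<nu> i. \<forall>l<\<nu> i. Amat \<Sigma>' $$ (pos \<nu> i k, pos \<nu> i l) = Free)"

definition trivial_dynamics :: "(nat \<Rightarrow> nat) \<Rightarrow> structured_system \<Rightarrow> nat \<Rightarrow> bool" where
  "trivial_dynamics \<nu> \<Sigma>' i \<longleftrightarrow>
     (\<forall>k<\<nu> i. \<forall>l<\<nu> i. Amat \<Sigma>' $$ (pos \<nu> i k, pos \<nu> i l) = Fixed 0)"

definition extended_system ::
    "structured_system \<Rightarrow> (nat \<Rightarrow> nat) \<Rightarrow> structured_system \<Rightarrow> bool" where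
  "extended_system \<Sigma> \<nu> \<Sigma>' \<longleftrightarrow>
     (let n = num_subsystems \<Sigma>; m = num_inputs \<Sigma>; N = (\<Sum>i<n. \<nu> i) in
       (\<forall>i<n. 1 \<le> \<nu> i) \<and>
       Amat \<Sigma>' \<in> carrier_mat N N \<and> Bmat \<Sigma>' \<in> carrier_mat N m \<and> Cmat \<Sigma>' \<in> carrier_mat n N \<and>
       (\<forall>i<n. \<forall>j<n. i \<noteq> j \<longrightarrow> (\<forall>k<\<nu> i. \<forall>l<\<nu> j.
          Amat \<Sigma>' $$ (pos \<nu> i k, pos \<nu> j l) = Fixed 0 \<or>
          Amat \<Sigma>' $$ (pos \<nu> i k, pos \<nu> j l) = Free \<and> Amat \<Sigma> $$ (i, j) = Free)) \<and>
       (\<forall>i<n. \<forall>s<m. \<forall>k<\<nu> i.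
          Bmat \<Sigma>' $$ (pos \<nu> i k, s) = Fixed 0 \<or>
          Bmat \<Sigma>' $$ (pos \<nu> i k, s) = Free \<and> Bmat \<Sigma> $$ (i, s) = Free) \<and>
       (\<forall>i<n. heterogeneous \<nu> \<Sigma>' i \<or> trivial_dynamics \<nu> \<Sigma>' i) \<and>
       (\<forall>i<n. \<forall>j<n. \<forall>l<\<nu> j.
          Cmat \<Sigma>' $$ (i, pos \<nu> j l) =
            (if i \<noteq> j then Fixed 0 else if 1 < \<nu> i then Free else Fixed 1)))"

definition higher_order :: "(nat \<Rightarrow> nat) \<Rightarrow> nat \<Rightarrow> bool" where
  "higher_order \<nu> i \<longleftrightarrow> 1 < \<nu> i"

definition first_order_heterogeneous :: "(nat \<Rightarrow> nat) \<Rightarrow> structured_system \<Rightarrow> nat \<Rightarrow> bool" where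
  "first_order_heterogeneous \<nu> \<Sigma>' i \<longleftrightarrow> \<nu> i = 1 \<and> heterogeneous \<nu> \<Sigma>' i"

definition unmodified :: "(nat \<Rightarrow> nat) \<Rightarrow> structured_system \<Rightarrow> nat \<Rightarrow> bool" where
  "unmodified \<nu> \<Sigma>' i \<longleftrightarrow> \<nu> i = 1 \<and> trivial_dynamics \<nu> \<Sigma>' i"


section \<open>The index\<close>

definition first_order_counts :: "structured_system \<Rightarrow> nat set" where
  "first_order_counts \<Sigma> =
     {card {i. i < num_subsystems \<Sigma> \<and> first_order_heterogeneous \<nu> \<Sigma>' i} | \<nu> \<Sigma>'.
        extended_system \<Sigma> \<nu> \<Sigma>' \<and> (\<forall>i<num_subsystems \<Sigma>. \<nu> i = 1) \<and>
        structurally_output_controllable \<Sigma>'}"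

text \<open>Meaningful only if \<^term>\<open>first_order_counts \<Sigma>\<close> is nonempty.\<close>

definition S_index :: "structured_system \<Rightarrow> nat" where
  "S_index \<Sigma> = (LEAST s. s \<in> first_order_counts \<Sigma>)"

definition S_hat :: "structured_system \<Rightarrow> (nat \<Rightarrow> nat) \<Rightarrow> nat" where
  "S_hat \<Sigma> \<nu> = card {i. i < num_subsystems \<Sigma> \<and> higher_order \<nu> i}"

definition Delta :: "structured_system \<Rightarrow> (nat \<Rightarrow> nat) \<Rightarrow> int" where
  "Delta \<Sigma> \<nu> = int (S_index \<Sigma>) - int (S_hat \<Sigma> \<nu>)"


section \<open>Graph, stems and cycles\<close>

datatype node = State nat | Input nat

definition network_graph :: "structured_system \<Rightarrow> node pair_pre_digraph" where
  "network_graph \<Sigma> =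
     (let n = num_subsystems \<Sigma>; m = num_inputs \<Sigma> in
       \<lparr> pverts = State ` {..<n} \<union> Input ` {..<m},
         parcs = {(State i, State j) | i j. i < n \<and> j < n \<and> Amat \<Sigma> $$ (j, i) = Free} \<union>
                 {(Input i, State j) | i j. i < m \<and> j < n \<and> Bmat \<Sigma> $$ (j, i) = Free} \<rparr>)"

definition stem :: "structured_system \<Rightarrow> node list \<Rightarrow> bool" where
  "stem \<Sigma> p \<longleftrightarrow> vpath p (with_proj (network_graph \<Sigma>)) \<and>
     (\<exists>s. hd p = Input s) \<and> (\<exists>i. last p = State i)"

text \<open>The length condition excludes one-node sequences, which are closed but have no edge.\<close>

definition closed_cycle :: "structured_system \<Rightarrow> node list \<Rightarrow> bool" where
  "closed_cycle \<Sigma> c \<longleftrightarrow> vwalk c (with_proj (network_graph \<Sigma>)) \<and>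
     2 \<le> length c \<and> hd c = last c \<and> distinct (butlast c)"

text \<open>Closed sequences that differ only in the choice of the starting node are the same cycle.\<close>

definition same_cycle :: "node list \<Rightarrow> node list \<Rightarrow> bool" where
  "same_cycle c c' \<longleftrightarrow> (\<exists>r. butlast c' = rotate r (butlast c))"

text \<open>A set of stems and cycles is given by its set \<open>Ps\<close> of stems and its set \<open>Pc\<close> of cycles.\<close>

definition covers_states :: "structured_system \<Rightarrow> node list set \<Rightarrow> node list set \<Rightarrow> bool" where
  "covers_states \<Sigma> Ps Pc \<longleftrightarrow> (\<forall>i<num_subsystems \<Sigma>. \<exists>p\<in>Ps \<union> Pc. State i \<in> set p)"

definition input_accessible :: "structured_system \<Rightarrow> bool" where
  "input_accessible \<Sigma> \<longleftrightarrow> (\<forall>i<num_subsystems \<Sigma>. \<exists>p. stem \<Sigma> p \<and> last p = State i)"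

definition stem_meets_cycle :: "node list set \<Rightarrow> node list set \<Rightarrow> bool" where
  "stem_meets_cycle Ps Pc \<longleftrightarrow> (\<exists>p\<in>Ps. \<exists>c\<in>Pc. set p \<inter> set c \<noteq> {})"

definition distinct_cycles_meet :: "node list set \<Rightarrow> bool" where
  "distinct_cycles_meet Pc \<longleftrightarrow>
     (\<exists>c\<in>Pc. \<exists>c'\<in>Pc. \<not> same_cycle c c' \<and> set c \<inter> set c' \<noteq> {})"

definition stems_of_different_inputs_meet :: "node list set \<Rightarrow> bool" where
  "stems_of_different_inputs_meet Ps \<longleftrightarrow>
     (\<exists>p\<in>Ps. \<exists>p'\<in>Ps. hd p \<noteq> hd p' \<and> set p \<inter> set p' \<noteq> {})"

definition distinct_stems_of_same_input :: "node list set \<Rightarrow> bool" where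
  "distinct_stems_of_same_input Ps \<longleftrightarrow> (\<exists>p\<in>Ps. \<exists>p'\<in>Ps. p \<noteq> p' \<and> hd p = hd p')"

definition X_network :: "structured_system \<Rightarrow> bool" where
  "X_network \<Sigma> \<longleftrightarrow> network \<Sigma> \<and> input_accessible \<Sigma> \<and> \<not> structurally_controllable \<Sigma> \<and>
     (\<exists>Ps Pc. (\<forall>p\<in>Ps. stem \<Sigma> p) \<and> (\<forall>c\<in>Pc. closed_cycle \<Sigma> c) \<and> covers_states \<Sigma> Ps Pc \<and>
        (stem_meets_cycle Ps Pc \<or> distinct_cycles_meet Pc \<or> stems_of_different_inputs_meet Ps) \<and>
        \<not> distinct_stems_of_same_input Ps)"

end

theory Submission
  imports Defs "HOL-Computational_Algebra.Polynomial"
begin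

text \<open>The witness is a star: one input drives a hub, which is joined to each of \<open>K\<close> leaves by a
  2-cycle. Two leaves without internal dynamics give proportional rows of \<open>[A B]\<close>, so first-order
  replacements must touch at least \<open>K - 1\<close> leaves. Replacing only the hub, by a system of order
  \<open>K + 1\<close>, lets it send an independent signal to every leaf; hence \<open>\<Delta> \<ge> K - 2\<close>.\<close>

section \<open>Full row rank\<close>

text \<open>The rank is the size of a maximal independent set of columns. If it equals
  \<open>n\<close>, such a set is a basis of the whole space; conversely, a full span has dimension
  \<open>n\<close>.\<close>

lemma full_row_rank_iff_span:
  assumes "M \<in> carrier_mat n nc"
  shows "full_row_rank M \<longleftrightarrow>
    LinearCombinations.module.span class_ring (module_vec TYPE(real) n) (set (cols M)) = carrier_vec n"
proof -
  interpret vec_space "TYPE(real)" n .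
  have M: "set (cols M) \<subseteq> carrier_vec n" using assms cols_dim by blast
  have dim_row: "dim_row M = n" using assms by simp
  show ?thesis
  proof
    assume "full_row_rank M"
    then have r: "rank M = n" by (simp add: full_row_rank_def dim_row)
    obtain S where S: "maximal S (\<lambda>T. T \<subseteq> set (cols M) \<and> lin_indpt T)"
      using maximal_exists_superset[of "set (cols M)" "\<lambda>T. T \<subseteq> set (cols M) \<and> lin_indpt T" "{}"]
      by (auto simp: lin_dep_def)
    then have "card S = n" using rank_card_indpt[OF assms S] r by simp
    moreover have sub: "S \<subseteq> set (cols M)" and "lin_indpt S" using S by (auto simp: maximal_def)
    moreover have "finite S" using sub finite_subset by blast
    ultimately have "basis S" using dim_li_is_basis[OF fin_dim] M dim_is_n by auto
    then have "span S = carrier_vec n" by (simp add: basis_def)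
    then show "span (set (cols M)) = carrier_vec n"
      using span_is_monotone[OF sub] span_closed[OF M] by auto
  next
    assume "span (set (cols M)) = carrier_vec n"
    moreover have "vs (carrier_vec n) = V" by (simp add: module_vec_def)
    ultimately have "rank M = dim" by (simp only: rank_def)
    then show "full_row_rank M" by (simp add: full_row_rank_def dim_row dim_is_n)
  qed
qed

text \<open>Reduces rank to finite sums, the form in which both the obstruction and the explicit
  systems are checked. A left kernel vector is orthogonal to the columns, hence to their
  span.\<close>

lemma full_row_rank_iff_left_kernel:
  assumes M: "M \<in> carrier_mat n nc"
  shows "full_row_rank M \<longleftrightarrow>
    (\<forall>f. (\<forall>c<nc. (\<Sum>l<n. f l * M $$ (l, c)) = 0) \<longrightarrow> (\<forall>l<n. f l = 0))"
  (is "_ \<longleftrightarrow> ?inj")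
proof -
  interpret vec_space "TYPE(real)" n .
  have cM: "set (cols M) \<subseteq> carrier_vec n" using M cols_dim by blast
  show ?thesis
  proof
    assume "full_row_rank M"
    then have span: "span (set (cols M)) = carrier_vec n" using full_row_rank_iff_span[OF M] by simp
    show ?inj
    proof (intro allI impI)
      fix f l assume f: "\<forall>c<nc. (\<Sum>l<n. f l * M $$ (l, c)) = 0" and l: "l < n"
      define v where "v = vec n f"
      have "v \<bullet> col M c = 0" if "c < nc" for c
      proof -
        have "v \<bullet> col M c = (\<Sum>l<n. f l * M $$ (l, c))"
          unfolding scalar_prod_def v_def using that M
          by (intro sum.cong) (auto simp: atLeast0LessThan)
        then show ?thesis using f that by simp
      qed
      moreover have "v \<in> carrier_vec n" by (simp add: v_def)
      ultimately have "v \<in> orthogonal_complement (set (cols M))"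
        using M by (auto simp: orthogonal_complement_def cols_def)
      then have "v \<in> orthogonal_complement (carrier_vec n)"
        using in_orthogonal_complement_span[OF cM] span by simp
      then have "v \<bullet> unit_vec n l = 0" by (simp add: orthogonal_complement_def)
      then show "f l = 0" using l by (simp add: v_def)
    qed
  next
    assume inj: ?inj
    \<comment> \<open>Over the reals a trivial left kernel makes the Gram matrix of the rows invertible, and its
      columns lie in the column space of \<open>M\<close>.\<close>
    define D where "D = M * transpose_mat M"
    have D: "D \<in> carrier_mat n n" unfolding D_def using M by (intro mult_carrier_mat[of _ n nc]) auto
    have "v = 0\<^sub>v n" if v: "v \<in> carrier_vec n" and Dv: "D *\<^sub>v v = 0\<^sub>v n" for v
    proof -
      define w where "w = transpose_mat M *\<^sub>v v"
      have w: "w \<in> carrier_vec (nc)" using M v by (simp add: w_def)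
      have "M *\<^sub>v w = 0\<^sub>v n" using Dv M v by (simp add: D_def w_def assoc_mult_mat_vec)
      \<comment> \<open>Since \<open>w\<close> is the transpose of \<open>M\<close> applied to
        \<open>v\<close>, this product is the squared norm of \<open>w\<close>.\<close>
      then have "v \<bullet> (M *\<^sub>v w) = 0" using v by simp
      then have "w \<bullet> w = 0"
        using transpose_vec_mult_scalar[OF M w v] M v w by (simp add: w_def)
      then have "(\<Sum>c<nc. w $ c * w $ c) = 0"
        using w by (simp add: scalar_prod_def atLeast0LessThan)
      then have "\<forall>c\<in>{..<nc}. w $ c * w $ c = 0"
        by (subst (asm) sum_nonneg_eq_0_iff) auto
      then have "w $ c = 0" if "c < nc" for c using that by auto
      moreover have "w $ c = (\<Sum>l<n. v $ l * M $$ (l, c))" if "c < nc" for c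
        unfolding w_def using that v M
        by (auto simp: scalar_prod_def atLeast0LessThan mult.commute intro!: sum.cong)
      ultimately have "\<forall>l<n. v $ l = 0" using inj by simp
      then show ?thesis using v by (intro eq_vecI) auto
    qed
    then have "det D \<noteq> 0" using det_0_iff_vec_prod_zero_field[OF D] by blast
    then have "span (set (cols D)) = carrier_vec n"
      using full_row_rank_iff_span[OF D] det_rank_iff[OF D] D by (simp add: full_row_rank_def)
    moreover have "set (cols D) \<subseteq> span (set (cols M))"
    proof
      fix x assume "x \<in> set (cols D)"
      then obtain j where j: "j < n" and x: "x = col D j" using D by (auto simp: cols_def)
      have "x = M *\<^sub>v col (transpose_mat M) j"
        unfolding x D_def using j M by (intro col_mult2) auto
      moreover have "M *\<^sub>v y \<in> col_space M" if "y \<in> carrier_vec (nc)" for y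
        using col_space_eq[OF M] that M by auto
      moreover have "col (transpose_mat M) j \<in> carrier_vec nc" using M by (simp add: carrier_vecI)
      ultimately show "x \<in> span (set (cols M))"
        by (simp add: col_space_def)
    qed
    then have "span (set (cols D)) \<subseteq> span (set (cols M))"
      using cM by (meson span_is_subset span_is_submodule)
    ultimately have "span (set (cols M)) = carrier_vec n" using span_closed[OF cM] by auto
    then show "full_row_rank M" using full_row_rank_iff_span[OF M] by simp
  qed
qed

section \<open>Iterates of A on B, and an obstruction to controllability\<close>

text \<open>Matrix powers grow by a factor on the right, while the recursion for the iterates needs
  it on the left. The induction varies \<open>B\<close> because its hypothesis is applied to
  \<open>A * B\<close>.\<close>

lemma pow_mat_Suc_mult:
  assumes "A \<in> carrier_mat n n" "B \<in> carrier_mat n m"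
  shows "A ^\<^sub>m Suc q * B = A * (A ^\<^sub>m q * B)"
  using assms(2)
proof (induction q arbitrary: B m)
  case 0
  then show ?case using assms(1) by simp
next
  case (Suc q)
  have pow: "A ^\<^sub>m k \<in> carrier_mat n n" for k using assms(1) by (rule pow_carrier_mat)
  have "A ^\<^sub>m Suc (Suc q) * B = A ^\<^sub>m Suc q * (A * B)"
    using assoc_mult_mat[OF pow assms(1) Suc.prems, of "Suc q"] by simp
  also have "\<dots> = A * (A ^\<^sub>m q * (A * B))"
    using Suc.IH[of "A * B" m] assms(1) Suc.prems by simp
  also have "A ^\<^sub>m q * (A * B) = A ^\<^sub>m Suc q * B"
    using assoc_mult_mat[OF pow assms(1) Suc.prems, of q] by simp
  finally show ?case .
qed

lemma index_mult_mat_sum: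
  assumes "A \<in> carrier_mat n k" "B \<in> carrier_mat k m" "i < n" "j < m"
  shows "(A * B) $$ (i, j) = (\<Sum>l<k. A $$ (i, l) * B $$ (l, j))"
  using assms by (auto simp: scalar_prod_def atLeast0LessThan intro!: sum.cong)

text \<open>The Hautus obstruction at eigenvalue 0: a row vector annihilating \<open>A\<close> and
  \<open>B\<close> annihilates every block of the controllability matrix.\<close>

lemma not_controllable_if_left_null:
  assumes A: "A \<in> carrier_mat n n" and B: "B \<in> carrier_mat n m"
    and fA: "\<And>c. c < n \<Longrightarrow> (\<Sum>l<n. f l * A $$ (l, c)) = 0"
    and fB: "\<And>s. s < m \<Longrightarrow> (\<Sum>l<n. f l * B $$ (l, s)) = 0"
    and l0: "l0 < n" "f l0 \<noteq> 0"
  shows "\<not> full_row_rank (controllability_matrix A B)"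
proof -
  have pow: "(\<Sum>l<n. f l * (A ^\<^sub>m q * B) $$ (l, s)) = 0" if s: "s < m" for q s
  proof (cases q)
    case 0
    then show ?thesis using fB[OF s] A B by simp
  next
    case (Suc p)
    let ?X = "A ^\<^sub>m p * B"
    have X: "?X \<in> carrier_mat n m" using pow_carrier_mat[OF A] B by (rule mult_carrier_mat)
    have "(\<Sum>l<n. f l * (A ^\<^sub>m q * B) $$ (l, s)) = (\<Sum>l<n. f l * (\<Sum>k<n. A $$ (l, k) * ?X $$ (k, s)))"
      unfolding Suc pow_mat_Suc_mult[OF A B]
      by (intro sum.cong refl arg_cong2[where f = "(*)"] index_mult_mat_sum[OF A X]) (auto simp: s)
    also have "\<dots> = (\<Sum>k<n. (\<Sum>l<n. f l * A $$ (l, k)) * ?X $$ (k, s))"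
      unfolding sum_distrib_left sum_distrib_right
      by (subst sum.swap) (simp add: mult.assoc)
    also have "\<dots> = 0" using fA by simp
    finally show ?thesis .
  qed
  have "(\<Sum>l<n. f l * controllability_matrix A B $$ (l, c)) = 0" if c: "c < n * m" for c
  proof -
    \<comment> \<open>The bound on \<open>c\<close> excludes \<open>m = 0\<close>.\<close>
    have "c mod m < m" using c by (cases m) auto
    moreover have "(\<Sum>l<n. f l * controllability_matrix A B $$ (l, c)) =
        (\<Sum>l<n. f l * (A ^\<^sub>m (c div m) * B) $$ (l, c mod m))"
      using A B c by (intro sum.cong) (auto simp: controllability_matrix_def)
    ultimately show ?thesis using pow by simp
  qed
  moreover have "controllability_matrix A B \<in> carrier_mat n (n * m)"
    using A B by (simp add: controllability_matrix_def)
  ultimately show ?thesis using full_row_rank_iff_left_kernel l0 by blast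
qed

text \<open>Rows supported in the single column \<open>h\<close> are linearly dependent, and
  \<open>B\<close> vanishes on both, so one nontrivial combination annihilates \<open>A\<close> and
  \<open>B\<close>.\<close>

lemma not_controllable_if_two_rows_in_one_column:
  assumes A: "A \<in> carrier_mat n n" and B: "B \<in> carrier_mat n m"
    and ij: "i < n" "j < n" "i \<noteq> j"
    and A0: "\<And>c. c < n \<Longrightarrow> c \<noteq> h \<Longrightarrow> A $$ (i, c) = 0 \<and> A $$ (j, c) = 0"
    and B0: "\<And>s. s < m \<Longrightarrow> B $$ (i, s) = 0 \<and> B $$ (j, s) = 0"
  shows "\<not> full_row_rank (controllability_matrix A B)"
proof -
  obtain a b where ab: "a * A $$ (i, h) + b * A $$ (j, h) = 0" and nz: "a \<noteq> 0 \<or> b \<noteq> 0"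
  proof (cases "A $$ (i, h) = 0")
    case True
    then show ?thesis using that[of 1 0] by simp
  next
    case False
    then show ?thesis using that[of "A $$ (j, h)" "- A $$ (i, h)"] by simp
  qed
  \<comment> \<open>As \<open>i\<close> and \<open>j\<close> differ, the summands do not overlap, so
    a nonzero coefficient remains a nonzero value of \<open>f\<close>.\<close>
  define f where "f l = (if l = i then a else 0) + (if l = j then b else 0)" for l
  have f_sum: "(\<Sum>l<n. f l * g l) = a * g i + b * g j" for g
    unfolding f_def distrib_right sum.distrib using ij
    by (simp add: if_distrib[of "\<lambda>x. x * _"] cong: if_cong)
  have "(\<Sum>l<n. f l * A $$ (l, c)) = 0" if "c < n" for c
    unfolding f_sum using A0[OF that] ab by (cases "c = h") auto
  moreover have "(\<Sum>l<n. f l * B $$ (l, s)) = 0" if "s < m" for s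
    unfolding f_sum using B0[OF that] by simp
  moreover have "\<exists>l<n. f l \<noteq> 0" using nz ij by (auto simp: f_def)
  ultimately show ?thesis using not_controllable_if_left_null[OF A B] by blast
qed

section \<open>Vandermonde systems\<close>

text \<open>Injectivity of a Vandermonde system. The polynomial \<open>p\<close> vanishes at every
  node except \<open>x k\<close> and has degree below \<open>card I\<close>, so pairing the weights
  with it isolates \<open>w k\<close>, while the moments make that pairing zero.\<close>

lemma vanishing_moments_imp_zero:
  fixes x w :: "'i \<Rightarrow> 'a::field"
  assumes fin: "finite I" and inj: "inj_on x I"
    and moments: "\<And>q. q < card I \<Longrightarrow> (\<Sum>i\<in>I. w i * x i ^ q) = 0"
    and k: "k \<in> I"
  shows "w k = 0"
proof -
  define p where "p = (\<Prod>j\<in>I - {k}. [:- x j, 1:])"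
  have "degree p = card (I - {k})"
    unfolding p_def by (subst degree_prod_eq_sum_degree) auto
  then have deg: "degree p < card I"
    using card_Diff1_less[OF fin k] by simp
  have root: "poly p (x i) = 0" if "i \<in> I - {k}" for i
    unfolding p_def poly_prod using fin that by (intro prod_zero) auto
  have "poly p (x k) \<noteq> 0"
    unfolding p_def poly_prod using fin inj k by (auto simp: inj_on_def)
  moreover have "w k * poly p (x k) = (\<Sum>i\<in>I. w i * poly p (x i))"
    using fin k root by (subst sum.remove[OF fin k]) auto
  moreover have "\<dots> = (\<Sum>q\<le>degree p. coeff p q * (\<Sum>i\<in>I. w i * x i ^ q))"
    unfolding poly_altdef sum_distrib_left by (subst sum.swap) (simp add: mult_ac)
  moreover have "\<dots> = 0" using moments deg by simp
  ultimately show ?thesis by auto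
qed

section \<open>The star network\<close>

text \<open>Node \<open>0\<close> is the hub, receiving the only input, and nodes \<open>1, \<dots>, K\<close> are the leaves.\<close>

definition identity_output :: "nat \<Rightarrow> entry mat" where
  "identity_output n = mat n n (\<lambda>(i, j). Fixed (if i = j then 1 else 0))"

definition star :: "nat \<Rightarrow> structured_system" where
  "star K = \<lparr>
     Amat = mat (Suc K) (Suc K) (\<lambda>(i, j). if (i = 0) \<noteq> (j = 0) then Free else Fixed 0),
     Bmat = mat (Suc K) 1 (\<lambda>(i, s). if i = 0 then Free else Fixed 0),
     Cmat = identity_output (Suc K)\<rparr>"

text \<open>The extreme first-order replacement: every subsystem, the hub included, gets a free
  self-loop.\<close>

definition heterogeneous_star :: "nat \<Rightarrow> structured_system" where
  "heterogeneous_star K = \<lparr>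
     Amat = mat (Suc K) (Suc K) (\<lambda>(i, j). if i = j \<or> (i = 0) \<noteq> (j = 0) then Free else Fixed 0),
     Bmat = mat (Suc K) 1 (\<lambda>(i, s). if i = 0 then Free else Fixed 0),
     Cmat = identity_output (Suc K)\<rparr>"

definition hub_order :: "nat \<Rightarrow> nat \<Rightarrow> nat" where
  "hub_order K i = (if i = 0 then Suc K else 1)"

text \<open>Position \<open>p\<close> of the extended state belongs to subsystem \<open>p - K\<close>: truncated subtraction sends
  the positions \<open>0, \<dots>, K\<close> of the hub to \<open>0\<close>.\<close>

definition extended_star :: "nat \<Rightarrow> structured_system" where
  "extended_star K = \<lparr>
     Amat = mat (Suc (2 * K)) (Suc (2 * K)) (\<lambda>(p, q). if p \<le> K \<or> q \<le> K then Free else Fixed 0),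
     Bmat = mat (Suc (2 * K)) 1 (\<lambda>(p, s). if p \<le> K then Free else Fixed 0),
     Cmat = mat (Suc K) (Suc (2 * K))
       (\<lambda>(i, q). if i \<noteq> q - K then Fixed 0 else if i = 0 then Free else Fixed 1)\<rparr>"

lemma star_simps [simp]:
  "num_subsystems (star K) = Suc K" "num_inputs (star K) = 1"
  "dim_col (Amat (star K)) = Suc K" "dim_row (Bmat (star K)) = Suc K"
  by (simp_all add: star_def)

lemma Amat_star:
  "i \<le> K \<Longrightarrow> j \<le> K \<Longrightarrow> Amat (star K) $$ (i, j) = (if (i = 0) \<noteq> (j = 0) then Free else Fixed 0)"
  by (simp add: star_def)

lemma Bmat_star: "i \<le> K \<Longrightarrow> Bmat (star K) $$ (i, 0) = (if i = 0 then Free else Fixed 0)"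
  by (simp add: star_def)

lemma network_star: "network (star K)"
  by (auto simp: network_def Let_def star_def identity_output_def)

subsection \<open>The star is an X-network\<close>

lemma network_graph_star:
  "network_graph (star K) =
    \<lparr> pverts = State ` {..K} \<union> {Input 0},
      parcs = {(State i, State j) | i j. i \<le> K \<and> j \<le> K \<and> (i = 0) \<noteq> (j = 0)} \<union>
        {(Input 0, State 0)} \<rparr>"
  by (auto simp: network_graph_def Let_def Amat_star Bmat_star less_Suc_eq_le lessThan_Suc_atMost
      split: if_splits)

lemma stem_star_hub: "stem (star K) [Input 0, State 0]"
  by (auto simp: stem_def vpath_def vwalk_def network_graph_star)

lemma stem_star_leaf: "1 \<le> i \<Longrightarrow> i \<le> K \<Longrightarrow> stem (star K) [Input 0, State 0, State i]"
  by (auto simp: stem_def vpath_def vwalk_def network_graph_star)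

lemma closed_cycle_star:
  "1 \<le> i \<Longrightarrow> i \<le> K \<Longrightarrow> closed_cycle (star K) [State 0, State i, State 0]"
  by (auto simp: closed_cycle_def vwalk_def network_graph_star)

lemma input_accessible_star: "input_accessible (star K)"
  unfolding input_accessible_def
proof (intro allI impI)
  fix i assume "i < num_subsystems (star K)"
  then have "i \<le> K" by simp
  then show "\<exists>p. stem (star K) p \<and> last p = State i"
    using stem_star_hub[of K] stem_star_leaf[of i K] by (cases "i = 0") fastforce+
qed

lemma not_structurally_controllable_star:
  assumes "2 \<le> K"
  shows "\<not> structurally_controllable (star K)"
proof
  assume "structurally_controllable (star K)"
  then obtain A B where A: "realises A (Amat (star K))" and B: "realises B (Bmat (star K))"
    and full: "full_row_rank (controllability_matrix A B)"
    by (auto simp: structurally_controllable_def)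
  have cA: "A \<in> carrier_mat (Suc K) (Suc K)" and cB: "B \<in> carrier_mat (Suc K) 1"
    using A B by (simp_all add: realises_def)
  have "A $$ (i, c) = 0" if "i \<in> {1, 2}" "c < Suc K" "c \<noteq> 0" for i c
    using A that assms Amat_star[of i K c] by (auto simp: realises_def)
  moreover have "B $$ (i, s) = 0" if "i \<in> {1, 2}" "s < 1" for i s
    using B that assms Bmat_star[of i K] by (auto simp: realises_def)
  \<comment> \<open>Leaves 1 and 2 exist because \<open>2 \<le> K\<close>; both are fed only by the
    hub, column 0.\<close>
  ultimately show False
    using not_controllable_if_two_rows_in_one_column[OF cA cB, of 1 2 0] assms full by auto
qed

text \<open>The 2-cycles cover the leaves and all pass through the hub. The single stem ending at
  the hub therefore meets them, and a one-element set of stems cannot violate the last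
  condition.\<close>

lemma X_network_star:
  assumes "2 \<le> K"
  shows "X_network (star K)"
proof -
  let ?Ps = "{[Input 0, State 0]}" and ?Pc = "(\<lambda>i. [State 0, State i, State 0]) ` {1..K}"
  have "covers_states (star K) ?Ps ?Pc"
    unfolding covers_states_def
  proof (intro allI impI)
    fix i assume "i < num_subsystems (star K)"
    then show "\<exists>p\<in>?Ps \<union> ?Pc. State i \<in> set p" by (cases "i = 0") auto
  qed
  moreover have "stem_meets_cycle ?Ps ?Pc"
    using assms by (auto simp: stem_meets_cycle_def)
  moreover have "\<forall>p\<in>?Ps. stem (star K) p" "\<forall>c\<in>?Pc. closed_cycle (star K) c"
    using stem_star_hub closed_cycle_star by auto
  moreover have "\<not> distinct_stems_of_same_input ?Ps"
    by (auto simp: distinct_stems_of_same_input_def)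
  ultimately show ?thesis
    unfolding X_network_def
    using network_star input_accessible_star not_structurally_controllable_star[OF assms] by blast
qed

subsection \<open>First-order heterogeneous replacements\<close>

lemma pos_first_order: "\<forall>i<n. \<nu> i = 1 \<Longrightarrow> i < n \<Longrightarrow> pos \<nu> i k = i + k"
  by (simp add: pos_def)

lemma extended_system_heterogeneous_star:
  "extended_system (star K) (\<lambda>_. 1) (heterogeneous_star K)"
  by (auto simp: extended_system_def Let_def pos_def heterogeneous_def trivial_dynamics_def
      heterogeneous_star_def star_def identity_output_def)

text \<open>With all feedback to the hub switched off and self-loop gains \<open>1, \<dots>, K\<close> at the leaves, the
  controllability matrix is a unit column followed by a Vandermonde matrix.\<close>

lemma controllable_heterogeneous_star:
  "structurally_output_controllable (heterogeneous_star K)"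
proof -
  define A :: "real mat" where "A = mat (Suc K) (Suc K)
    (\<lambda>(i, j). if 1 \<le> i \<and> j = 0 then 1 else if i = j then real i else 0)"
  define B :: "real mat" where "B = mat (Suc K) 1 (\<lambda>(i, s). if i = 0 then 1 else 0)"
  define X :: "nat \<Rightarrow> real mat" where "X q = mat (Suc K) 1
    (\<lambda>(i, s). if q = 0 then (if i = 0 then 1 else 0) else if i = 0 then 0 else real i ^ (q - 1))" for q
  have A: "A \<in> carrier_mat (Suc K) (Suc K)" and B: "B \<in> carrier_mat (Suc K) 1"
    and X: "X q \<in> carrier_mat (Suc K) 1" for q
    by (simp_all add: A_def B_def X_def)
  have step: "A * X q = X (Suc q)" for q
  proof (rule eq_matI)
    fix i j assume "i < dim_row (X (Suc q))" "j < dim_col (X (Suc q))"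
    then have i: "i < Suc K" and j: "j = 0" by (auto simp: X_def)
    have "(A * X q) $$ (i, j) = (\<Sum>l<Suc K. A $$ (i, l) * X q $$ (l, j))"
      using index_mult_mat_sum[OF A X i] j by simp
    \<comment> \<open>Row \<open>i\<close> lives in column 0 and on the diagonal. For
      \<open>i = 0\<close> these coincide, but the hub gain \<open>real 0\<close> makes both terms
      vanish.\<close>
    also have "\<dots> = (\<Sum>l<Suc K. (if l = 0 then A $$ (i, 0) * X q $$ (0, 0) else 0) +
        (if l = i then real i * X q $$ (i, 0) else 0))"
      using i j by (intro sum.cong) (auto simp: A_def)
    also have "\<dots> = A $$ (i, 0) * X q $$ (0, 0) + real i * X q $$ (i, 0)"
      unfolding sum.distrib using i by (subst (1 2) sum.delta) auto
    also have "\<dots> = X (Suc q) $$ (i, j)"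
      using i j by (cases q) (auto simp: A_def X_def)
    finally show "(A * X q) $$ (i, j) = X (Suc q) $$ (i, j)" .
  qed (auto simp: A_def X_def)
  have pow: "A ^\<^sub>m q * B = X q" for q
  proof (induction q)
    case 0
    then show ?case using A B by (auto simp: B_def X_def intro!: eq_matI)
  next
    case (Suc q)
    then show ?case using pow_mat_Suc_mult[OF A B, of q] step by simp
  qed
  have R: "controllability_matrix A B \<in> carrier_mat (Suc K) (Suc K)"
    using A B by (simp add: controllability_matrix_def)
  have R_index: "controllability_matrix A B $$ (i, q) = X q $$ (i, 0)" if "i < Suc K" "q < Suc K" for i q
    using that A B by (simp add: controllability_matrix_def pow)
  have "f i = 0" if f: "\<forall>c<Suc K. (\<Sum>l<Suc K. f l * controllability_matrix A B $$ (l, c)) = 0"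
    and i: "i < Suc K" for f i
  proof -
    have f': "(\<Sum>l<Suc K. f l * X q $$ (l, 0)) = 0" if "q < Suc K" for q
      using f that R_index by simp
    have f0: "f 0 = 0" using f'[of 0] by (simp add: X_def sum.lessThan_Suc_shift del: sum.lessThan_Suc)
    \<comment> \<open>Column \<open>Suc q\<close> carries the moment of order \<open>q\<close>, so
      the columns after the first supply one moment per leaf.\<close>
    have moments: "(\<Sum>l\<in>{1..K}. f l * real l ^ q) = 0" if "q < card {1..K}" for q
      using f'[of "Suc q"] that f0
      by (simp add: X_def sum.lessThan_Suc_shift sum.atLeast1_atMost_eq del: sum.lessThan_Suc)
    show ?thesis
      using f0 i vanishing_moments_imp_zero[of "{1..K}" real f i] moments by (cases "i = 0") auto
  qed
  then have "full_row_rank (controllability_matrix A B)"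
    using full_row_rank_iff_left_kernel[OF R] by blast
  moreover have "1\<^sub>m (Suc K) * controllability_matrix A B = controllability_matrix A B"
    using R by simp
  moreover have "realises A (Amat (heterogeneous_star K))" "realises B (Bmat (heterogeneous_star K))"
    "realises (1\<^sub>m (Suc K)) (Cmat (heterogeneous_star K))"
    by (auto simp: realises_def heterogeneous_star_def identity_output_def A_def B_def split: if_splits)
  ultimately show ?thesis unfolding structurally_output_controllable_def by metis
qed

text \<open>Ensures that the minimum defining \<open>S_index\<close> is attained.\<close>

lemma first_order_counts_star_nonempty: "first_order_counts (star K) \<noteq> {}"
  unfolding first_order_counts_def
  using extended_system_heterogeneous_star controllable_heterogeneous_star by blast

text \<open>With all orders 1 the output matrix is forced to be the identity, so output
  controllability becomes full rank of the controllability matrix itself. Two leaves outside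
  \<open>H\<close> would contradict that rank, so at most one escapes.\<close>

lemma first_order_counts_star_ge:
  assumes "s \<in> first_order_counts (star K)"
  shows "K - 1 \<le> s"
proof -
  obtain \<nu> \<Sigma>' where s: "s = card {i. i < Suc K \<and> first_order_heterogeneous \<nu> \<Sigma>' i}"
    and ext: "extended_system (star K) \<nu> \<Sigma>'" and \<nu>: "\<forall>i<Suc K. \<nu> i = 1"
    and ctrl: "structurally_output_controllable \<Sigma>'"
    using assms unfolding first_order_counts_def star_simps by blast
  define H where "H = {i. i < Suc K \<and> first_order_heterogeneous \<nu> \<Sigma>' i}"
  have N: "(\<Sum>i<Suc K. \<nu> i) = Suc K" using \<nu> by simp
  have pos: "pos \<nu> i 0 = i" if "i < Suc K" for i using pos_first_order[OF \<nu> that] by simp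
  obtain A B C where A: "realises A (Amat \<Sigma>')" and B: "realises B (Bmat \<Sigma>')"
    and C: "realises C (Cmat \<Sigma>')" and full: "full_row_rank (C * controllability_matrix A B)"
    using ctrl by (auto simp: structurally_output_controllable_def)
  have dims: "Amat \<Sigma>' \<in> carrier_mat (Suc K) (Suc K)" "Bmat \<Sigma>' \<in> carrier_mat (Suc K) 1"
    "Cmat \<Sigma>' \<in> carrier_mat (Suc K) (Suc K)"
    using ext unfolding extended_system_def Let_def star_simps N by blast+
  have cA: "A \<in> carrier_mat (Suc K) (Suc K)" and cB: "B \<in> carrier_mat (Suc K) 1"
    and cC: "C \<in> carrier_mat (Suc K) (Suc K)"
    using A B C dims by (auto simp: realises_def)
  have "Cmat \<Sigma>' $$ (i, j) = Fixed (if i = j then 1 else 0)" if "i < Suc K" "j < Suc K" for i j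
  proof -
    have "Cmat \<Sigma>' $$ (i, pos \<nu> j 0) = (if i \<noteq> j then Fixed 0 else if 1 < \<nu> i then Free else Fixed 1)"
      using ext that \<nu> unfolding extended_system_def Let_def star_simps by simp
    then show ?thesis using pos that \<nu> by simp
  qed
  then have "C = 1\<^sub>m (Suc K)"
    using C dims cC by (intro eq_matI) (auto simp: realises_def)
  moreover have "controllability_matrix A B \<in> carrier_mat (Suc K) (Suc K)"
    using cA cB by (simp add: controllability_matrix_def)
  ultimately have full: "full_row_rank (controllability_matrix A B)" using full by simp
  have A0: "A $$ (i, c) = 0" if "i \<in> {1..K} - H" "c < Suc K" "c \<noteq> 0" for i c
  proof -
    have i: "i < Suc K" "i \<noteq> 0" using that by auto
    have "Amat \<Sigma>' $$ (i, c) = Fixed 0"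
    proof (cases "i = c")
      case True
      have "\<not> heterogeneous \<nu> \<Sigma>' i"
        using that i \<nu> by (auto simp: H_def first_order_heterogeneous_def)
      then have "trivial_dynamics \<nu> \<Sigma>' i"
        using ext i unfolding extended_system_def Let_def star_simps by blast
      then have "Amat \<Sigma>' $$ (pos \<nu> i 0, pos \<nu> i 0) = Fixed 0"
        using i \<nu> by (simp add: trivial_dynamics_def)
      then show ?thesis using pos i True by simp
    next
      case False
      have "Amat (star K) $$ (i, c) = Fixed 0" using i that by (simp add: Amat_star)
      moreover have "Amat \<Sigma>' $$ (pos \<nu> i 0, pos \<nu> c 0) = Fixed 0 \<or> Amat (star K) $$ (i, c) = Free"
        using ext i that False \<nu> unfolding extended_system_def Let_def star_simps by fastforce
      ultimately show ?thesis using pos i that by simp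
    qed
    then show ?thesis using A dims i that by (simp add: realises_def)
  qed
  have B0: "B $$ (i, s) = 0" if "i \<in> {1..K} - H" "s < 1" for i s
  proof -
    have i: "i < Suc K" "i \<noteq> 0" using that by auto
    have "Bmat (star K) $$ (i, 0) = Fixed 0" using i by (simp add: Bmat_star)
    moreover have "Bmat \<Sigma>' $$ (pos \<nu> i 0, 0) = Fixed 0 \<or> Bmat (star K) $$ (i, 0) = Free"
      using ext i \<nu> unfolding extended_system_def Let_def star_simps by fastforce
    ultimately show ?thesis using B dims i that pos by (simp add: realises_def)
  qed
  have "i = j" if "i \<in> {1..K} - H" "j \<in> {1..K} - H" for i j
    using not_controllable_if_two_rows_in_one_column[OF cA cB, of i j 0] A0 B0 that full by auto
  then have "card ({1..K} - H) \<le> 1"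
    by (simp add: card_le_Suc0_iff_eq)
  \<comment> \<open>\<open>H\<close> may also contain the hub, hence only an inequality.\<close>
  moreover have "card {1..K} \<le> card ({1..K} - H) + card H"
    using card_mono[of "({1..K} - H) \<union> H" "{1..K}"] card_Un_le[of "{1..K} - H" H]
    by (simp add: H_def)
  ultimately show ?thesis unfolding s H_def[symmetric] by simp
qed

lemma S_index_star_ge: "K - 1 \<le> S_index (star K)"
  unfolding S_index_def
  using first_order_counts_star_ge first_order_counts_star_nonempty
  by (metis (mono_tags) LeastI ex_in_conv)

subsection \<open>A hub of higher order\<close>

text \<open>Before leaf \<open>i\<close> come the \<open>K + 1\<close> hub components and
  \<open>i - 1\<close> leaves.\<close>

lemma pos_hub_order: "pos (hub_order K) i k = (if i = 0 then k else K + i + k)"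
  by (cases i) (simp_all add: pos_def hub_order_def sum.lessThan_Suc_shift del: sum.lessThan_Suc)

lemma sum_hub_order: "(\<Sum>i<Suc K. hub_order K i) = Suc (2 * K)"
  by (simp add: hub_order_def sum.lessThan_Suc_shift del: sum.lessThan_Suc)

text \<open>\<open>1 \<le> K\<close> gives the hub order at least 2, as its free output entries
  require.\<close>

lemma extended_system_extended_star:
  assumes "1 \<le> K"
  shows "extended_system (star K) (hub_order K) (extended_star K)"
  unfolding extended_system_def Let_def star_simps sum_hub_order
  using assms
  by (auto simp: pos_hub_order heterogeneous_def trivial_dynamics_def hub_order_def Amat_star
      Bmat_star extended_star_def split: if_splits)

text \<open>The hub is run as a chain of \<open>K + 1\<close> integrators fed by the input at its first component, leaf
  \<open>i\<close> copies what enters component \<open>i\<close> of the chain, and the first component is the hub's output.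
  Then the impulse reaches output \<open>q\<close> after exactly \<open>q\<close> steps.\<close>

lemma controllable_extended_star:
  assumes K: "1 \<le> K"
  shows "structurally_output_controllable (extended_star K)"
proof -
  let ?N = "Suc (2 * K)"
  define A :: "real mat" where "A = mat ?N ?N
    (\<lambda>(p, q). if q < K \<and> (p = Suc q \<or> p = K + Suc q) then 1 else 0)"
  define B :: "real mat" where "B = mat ?N 1 (\<lambda>(p, s). if p = 0 then 1 else 0)"
  define C :: "real mat" where "C = mat (Suc K) ?N
    (\<lambda>(i, p). if i = 0 \<and> p = 0 \<or> 1 \<le> i \<and> p = K + i then 1 else 0)"
  \<comment> \<open>After \<open>q\<close> steps the impulse sits at chain component
    \<open>q\<close> and, for positive \<open>q\<close>, at leaf \<open>q\<close>, whose position is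
    \<open>K + q\<close>.\<close>
  define X :: "nat \<Rightarrow> real mat" where "X q = mat ?N 1
    (\<lambda>(p, s). if p = q \<or> 1 \<le> q \<and> p = K + q then 1 else 0)" for q
  have A: "A \<in> carrier_mat ?N ?N" and B: "B \<in> carrier_mat ?N 1" and C: "C \<in> carrier_mat (Suc K) ?N"
    and X: "X q \<in> carrier_mat ?N 1" for q
    by (simp_all add: A_def B_def C_def X_def)
  have step: "A * X q = X (Suc q)" if q: "q < K" for q
  proof (rule eq_matI)
    fix p j assume "p < dim_row (X (Suc q))" "j < dim_col (X (Suc q))"
    then have p: "p < ?N" and j: "j = 0" by (auto simp: X_def)
    have "(A * X q) $$ (p, j) = (\<Sum>l<?N. A $$ (p, l) * X q $$ (l, j))"
      using index_mult_mat_sum[OF A X p] j by simp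
    \<comment> \<open>The entry of \<open>X q\<close> at leaf \<open>q\<close> drops out because the
      leaves feed nothing: columns of \<open>A\<close> from \<open>K\<close> on are zero.\<close>
    also have "\<dots> = (\<Sum>l<?N. if l = q then A $$ (p, q) else 0)"
      using p j q by (intro sum.cong) (auto simp: A_def X_def)
    also have "\<dots> = A $$ (p, q)" using q by simp
    also have "\<dots> = X (Suc q) $$ (p, j)" using p j q by (simp add: A_def X_def)
    finally show "(A * X q) $$ (p, j) = X (Suc q) $$ (p, j)" .
  qed (auto simp: A_def X_def)
  have pow: "q \<le> K \<Longrightarrow> A ^\<^sub>m q * B = X q" for q
  proof (induction q)
    case 0
    then show ?case using A B by (auto simp: B_def X_def intro!: eq_matI)
  next
    case (Suc q)
    then show ?case using pow_mat_Suc_mult[OF A B, of q] step by simp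
  qed
  let ?R = "controllability_matrix A B"
  have R: "?R \<in> carrier_mat ?N ?N"
    using A B by (simp add: controllability_matrix_def)
  have CR: "C * ?R \<in> carrier_mat (Suc K) ?N" using C R by (rule mult_carrier_mat)
  \<comment> \<open>The first \<open>K + 1\<close> of the \<open>2 * K + 1\<close> columns form an
    identity block, which already forces a trivial left kernel.\<close>
  have out: "(C * ?R) $$ (i, c) = (if i = c then 1 else 0)" if i: "i < Suc K" and c: "c < Suc K" for i c
  proof -
    have R_index: "?R $$ (p, c) = X c $$ (p, 0)" if "p < ?N" for p
      using A B c that pow[of c] by (simp add: controllability_matrix_def del: index_mult_mat)
    have "(C * ?R) $$ (i, c) = (\<Sum>p<?N. C $$ (i, p) * ?R $$ (p, c))"
      using c by (intro index_mult_mat_sum[OF C R i]) simp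
    also have "\<dots> = (\<Sum>p<?N. C $$ (i, p) * X c $$ (p, 0))"
      using R_index by simp
    also have "\<dots> = (\<Sum>p<?N. if p = (if i = 0 then 0 else K + i) then X c $$ (p, 0) else 0)"
      using i by (intro sum.cong) (auto simp: C_def)
    also have "\<dots> = X c $$ (if i = 0 then 0 else K + i, 0)"
      using i by (subst sum.delta) auto
    also have "\<dots> = (if i = c then 1 else 0)"
      using i c by (auto simp: X_def)
    finally show ?thesis .
  qed
  have "f i = 0" if f: "\<forall>c<?N. (\<Sum>l<Suc K. f l * (C * ?R) $$ (l, c)) = 0" and i: "i < Suc K" for f i
  proof -
    have "(\<Sum>l<Suc K. f l * (C * ?R) $$ (l, i)) = (\<Sum>l<Suc K. if l = i then f l else 0)"
      using out i by (intro sum.cong) auto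
    also have "\<dots> = f i" using i by (subst sum.delta) auto
    finally show ?thesis using f i by simp
  qed
  then have "full_row_rank (C * ?R)" using full_row_rank_iff_left_kernel[OF CR] by blast
  moreover have "realises A (Amat (extended_star K))" "realises B (Bmat (extended_star K))"
    "realises C (Cmat (extended_star K))"
    by (auto simp: realises_def extended_star_def A_def B_def C_def split: if_splits)
  ultimately show ?thesis unfolding structurally_output_controllable_def by metis
qed

lemma higher_order_or_unmodified_star:
  assumes "1 \<le> K" "i < Suc K"
  shows "higher_order (hub_order K) i \<or> unmodified (hub_order K) (extended_star K) i"
  using assms
  by (auto simp: higher_order_def unmodified_def trivial_dynamics_def pos_hub_order hub_order_def
      extended_star_def)

lemma S_hat_star:
  assumes "1 \<le> K"
  shows "S_hat (star K) (hub_order K) = 1"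
proof -
  have "{i. i < num_subsystems (star K) \<and> higher_order (hub_order K) i} = {0}"
    using assms by (auto simp: higher_order_def hub_order_def split: if_splits)
  then show ?thesis by (simp add: S_hat_def)
qed

theorem corollary3:
  shows "\<exists>(\<Sigma> :: nat \<Rightarrow> structured_system) (\<nu> :: nat \<Rightarrow> nat \<Rightarrow> nat) (\<Sigma>' :: nat \<Rightarrow> structured_system).
    (\<forall>k. X_network (\<Sigma> k) \<and> first_order_counts (\<Sigma> k) \<noteq> {} \<and>
         extended_system (\<Sigma> k) (\<nu> k) (\<Sigma>' k) \<and>
         structurally_output_controllable (\<Sigma>' k) \<and>
         (\<forall>i<num_subsystems (\<Sigma> k). higher_order (\<nu> k) i \<or> unmodified (\<nu> k) (\<Sigma>' k) i)) \<and>
    filterlim (\<lambda>k. num_subsystems (\<Sigma> k)) at_top sequentially \<and>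
    filterlim (\<lambda>k. Delta (\<Sigma> k) (\<nu> k)) at_top sequentially"
proof -
  \<comment> \<open>The shift ensures at least two leaves, as the X-network property requires, and
    turns the bound \<open>K - 2\<close> on the index into \<open>k\<close>.\<close>
  let ?K = "\<lambda>k. k + 2"
  have "X_network (star (?K k)) \<and> first_order_counts (star (?K k)) \<noteq> {} \<and>
      extended_system (star (?K k)) (hub_order (?K k)) (extended_star (?K k)) \<and>
      structurally_output_controllable (extended_star (?K k)) \<and>
      (\<forall>i<num_subsystems (star (?K k)).
        higher_order (hub_order (?K k)) i \<or> unmodified (hub_order (?K k)) (extended_star (?K k)) i)" for k
    using X_network_star[of "?K k"] first_order_counts_star_nonempty[of "?K k"]
      extended_system_extended_star[of "?K k"] controllable_extended_star[of "?K k"]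
      higher_order_or_unmodified_star[of "?K k"] by simp
  moreover have "filterlim (\<lambda>k. num_subsystems (star (?K k))) at_top sequentially"
    by (rule filterlim_at_top_mono[OF filterlim_ident]) simp
  moreover have "int k \<le> Delta (star (?K k)) (hub_order (?K k))" for k
    using S_index_star_ge[of "?K k"] S_hat_star[of "?K k"] by (simp add: Delta_def)
  then have "filterlim (\<lambda>k. Delta (star (?K k)) (hub_order (?K k))) at_top sequentially"
    by (intro filterlim_at_top_mono[OF filterlim_int_sequentially]) simp
  ultimately show ?thesis
    by (intro exI[of _ "\<lambda>k. star (?K k)"] exI[of _ "\<lambda>k. hub_order (?K k)"]
        exI[of _ "\<lambda>k. extended_star (?K k)"]) blast
qed

end
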